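(* Let $k$ be a field of characteristic $p\ge5$. Any exponential matrix $A(T)\in\mathrm{Mat}(4,k[T])$ is equivalent to one of the following exponential matrices (1), (2), (3), (4), (5), (6), (7): (1) $\begin{pmatrix}1&a&\frac12a^2+b&\frac16a^3+ab+c\\0&1&a&\frac12a^2+b\\0&0&1&a\\0&0&0&1\end{pmatrix}$, where $a,b,c$ are $p$-polynomials and $a\ne0$. (2) $\begin{pmatrix}1&a&\frac12a^2+b&c\\0&1&a&0\\0&0&1&0\\0&0&0&1\end{pmatrix}$, where $a,b,c$ are $p$-polynomials and $a\ne0$. (3) $\begin{pmatrix}1&0&0&c\\0&1&a&\frac12a^2+b\\0&0&1&a\\0&0&0&1\end{pmatrix}$, where $a,b,c$ are $p$-polynomials and $a\ne0$. (4) $\begin{pmatrix}1&a&b&c\\0&1&0&0\\0&0&1&0\\0&0&0&1\end{pmatrix}$, where $a,b,c$ are $p$-polynomials. (5) $\begin{pmatrix}1&0&a&b\\0&1&c&d\\0&0&1&0\\0&0&0&1\end{pmatrix}$, where $a,b,c,d$ are $p$-polynomials. (6) $\begin{pmatrix}1&0&0&a\\0&1&0&b\\0&0&1&c\\0&0&0&1\end{pmatrix}$, where $a,b,c$ are $p$-polynomials. (7) $\begin{pmatrix}1&a&b&\frac{\lambda}{2}a^2+\mu ab+\frac{\nu}{2}b^2+c\\0&1&0&\lambda a+\mu b\\0&0&1&\mu a+\nu b\\0&0&0&1\end{pmatrix}$, where $a,b,c$ are $p$-polynomials, $a,b$ are linearly independent over $k$, $\lambda,\mu,\nu\in k$, and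 $\lambda\nu-\mu^2\ne0$.
   Context: $k[T]$ is the polynomial ring in one variable over $k$. A matrix $A(T)\in\mathrm{Mat}(n,k[T])$ is exponential if $A(0)=I_n$ and $A(T)A(T')=A(T+T')$, where $T,T'$ are indeterminates over $k$. Two matrices $A(T),B(T)\in\mathrm{Mat}(n,k[T])$ are equivalent if $P^{-1}A(T)P=B(T)$ for some $P\in GL(n,k)$. A $p$-polynomial is a polynomial of the form $\sum_{i\ge0}c_iT^{p^i}\in k[T]$ with $c_i\in k$. *)

theory Defs
  imports "HOL-Analysis.Analysis" "HOL-Computational_Algebra.Computational_Algebra"
begin

(* The ring k[T, T'] is represented as 'k poly poly, with T the inner and T' the outer
   indeterminate. *)

definition indet_T :: "'k::field poly poly" where
  "indet_T = [:[:0, 1:]:]"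

definition indet_T' :: "'k::field poly poly" where
  "indet_T' = [:0, 1:]"

(* subst2 s A is A(s), the entrywise image of A(T) under the k-algebra homomorphism
   k[T] -> k[T, T'] sending T to s. *)
definition subst2 :: "'k::field poly poly \<Rightarrow> 'k poly^'n^'m \<Rightarrow> 'k poly poly^'n^'m" where
  "subst2 s A = map_matrix (\<lambda>f. poly (map_poly (\<lambda>c. [:[:c:]:]) f) s) A"

definition exponential_matrix :: "'k::field poly^'n^'n \<Rightarrow> bool" where
  "exponential_matrix A \<longleftrightarrow>
     map_matrix (\<lambda>f. poly f 0) A = mat 1 \<and>
     subst2 indet_T A ** subst2 indet_T' A = subst2 (indet_T + indet_T') A"

definition const_matrix :: "'k::field^'n^'m \<Rightarrow> 'k poly^'n^'m" where
  "const_matrix P = map_matrix (\<lambda>x. [:x:]) P"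

definition equivalent_matrix :: "'k::field poly^'n^'n \<Rightarrow> 'k poly^'n^'n \<Rightarrow> bool" where
  "equivalent_matrix A B \<longleftrightarrow>
     (\<exists>P. invertible P \<and> const_matrix (matrix_inv P) ** A ** const_matrix P = B)"

definition p_polynomial :: "nat \<Rightarrow> 'k::field poly \<Rightarrow> bool" where
  "p_polynomial p f \<longleftrightarrow> (\<exists>m c. f = (\<Sum>i<m. monom (c i) (p ^ i)))"

definition lin_indep_pair :: "'k::field poly \<Rightarrow> 'k poly \<Rightarrow> bool" where
  "lin_indep_pair a b \<longleftrightarrow> (\<forall>x y. smult x a + smult y b = 0 \<longrightarrow> x = 0 \<and> y = 0)"

end

theory Submission
  imports Defs "HOL-Algebra.Exponent"
begin

text \<open>
  Write \<open>A(T) = \<Sum> A\<^sub>i T\<^sup>i\<close>. Being exponential means \<open>A\<^sub>0 = 1\<close> and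
  \<open>A\<^sub>i A\<^sub>j = binomial(i + j, i) A\<^sub>i\<^sub>+\<^sub>j\<close>. This yields a full flag that every \<open>A\<^sub>i\<close>
  with \<open>i \<ge> 1\<close> lowers, so \<open>A\<close> may be taken upper unitriangular. As 2 and 3 are invertible,
  \<open>A = exp N\<close> for a strictly upper triangular \<open>N\<close>, whose entries turn out to be additive, that is,
  \<open>p\<close>-polynomials, and whose coefficient matrices commute. Conjugating \<open>A\<close> by a constant matrix
  conjugates \<open>N\<close>, so it remains to classify \<open>N\<close>. If the entry (2,3) is nonzero, the other two
  superdiagonal entries are multiples of it, which gives (1), (2), (3), (5). If it vanishes, either
  the entries (1,2) and (1,3) are independent and the last column is obtained from them by a symmetric
  2 by 2 matrix, of rank 2 in (7), of rank 0 in (4), and of rank 1 in a case that a permutation of the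
  basis takes to (2); or they can be made to be \<open>x, 0\<close>, and a permutation of the basis leads back
  to the first case unless \<open>x = 0\<close>, which is (6).
\<close>

text \<open>The polynomial libraries leave \<open>$\<close> overloaded with power series coefficients.\<close>

unbundle no Formal_Power_Series.fps_syntax

section \<open>Coefficients of exponential matrices and equivalence\<close>

lemma subst_pCons:
  "poly (map_poly (\<lambda>c. [:[:c:]:]) (pCons a f)) s
     = [:[:a:]:] + s * poly (map_poly (\<lambda>c. [:[:c:]:]) f) s"
  by (simp add: map_poly_pCons)

lemma subst_indet_T: "poly (map_poly (\<lambda>c. [:[:c:]:]) f) indet_T = [:f:]"
proof (induction f)
  case (pCons a f)
  then show ?case
    by (simp only: subst_pCons) (simp add: indet_T_def)
qed simp

lemma subst_indet_T': "poly (map_poly (\<lambda>c. [:[:c:]:]) f) indet_T' = map_poly (\<lambda>c. [:c:]) f"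
proof (induction f)
  case (pCons a f)
  then show ?case
    by (simp only: subst_pCons) (simp add: indet_T'_def map_poly_pCons)
qed simp

text \<open>The binomial theorem read off coefficientwise: only \<open>(T + T')^(i + j)\<close>
  contributes to the monomial \<open>T^i T'^j\<close>.\<close>

lemma coeff_subst_add:
  "coeff (coeff (poly (map_poly (\<lambda>c. [:[:c:]:]) f) (indet_T + indet_T')) j) i
     = of_nat (i + j choose i) * coeff f (i + j)"
proof (induction f arbitrary: i j)
  case (pCons a f)
  define g where "g = poly (map_poly (\<lambda>c. [:[:c:]:]) f) (indet_T + indet_T')"
  \<comment> \<open>Multiplication by \<open>T\<close> shifts the inner index
    (\<open>smult [:0, 1:]\<close>), multiplication by \<open>T'\<close> the outer one
    (\<open>pCons 0\<close>); what remains is Pascal's rule.\<close>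
  have "poly (map_poly (\<lambda>c. [:[:c:]:]) (pCons a f)) (indet_T + indet_T')
      = [:[:a:]:] + smult [:0, 1:] g + pCons 0 g"
    by (simp only: subst_pCons g_def [symmetric]) (simp add: indet_T_def indet_T'_def algebra_simps)
  then show ?case
    using pCons.IH [folded g_def]
    by (cases i; cases j) (simp_all add: algebra_simps)
qed simp

lemma coeff_subst_mult:
  "coeff (coeff (poly (map_poly (\<lambda>c. [:[:c:]:]) f) indet_T
               * poly (map_poly (\<lambda>c. [:[:c:]:]) g) indet_T') j) i = coeff f i * coeff g j"
  by (simp add: subst_indet_T subst_indet_T' coeff_map_poly mult.commute)

text \<open>Comparing the coefficients of \<open>T^i T'^j\<close> entry by entry removes the
  two-variable ring from the arguments on flags and conjugation.\<close>

lemma exponential_matrix_coeff: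
  "exponential_matrix A \<longleftrightarrow>
     (\<forall>r s. coeff (A $ r $ s) 0 = (if r = s then 1 else 0)) \<and>
     (\<forall>i j r s. (\<Sum>m\<in>UNIV. coeff (A $ r $ m) i * coeff (A $ m $ s) j)
        = of_nat (i + j choose i) * coeff (A $ r $ s) (i + j))"
  unfolding exponential_matrix_def
proof (intro arg_cong2 [of _ _ _ _ "(\<and>)"])
  show "map_matrix (\<lambda>f. poly f 0) A = mat 1 \<longleftrightarrow>
      (\<forall>r s. coeff (A $ r $ s) 0 = (if r = s then 1 else 0))"
    by (simp add: vec_eq_iff mat_def poly_0_coeff_0)
  have "subst2 indet_T A ** subst2 indet_T' A = subst2 (indet_T + indet_T') A \<longleftrightarrow>
     (\<forall>r s j i. coeff (coeff ((subst2 indet_T A ** subst2 indet_T' A) $ r $ s) j) i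
        = coeff (coeff (subst2 (indet_T + indet_T') A $ r $ s) j) i)"
    by (simp add: vec_eq_iff poly_eq_iff)
  also have "\<dots> \<longleftrightarrow> (\<forall>i j r s. (\<Sum>m\<in>UNIV. coeff (A $ r $ m) i * coeff (A $ m $ s) j)
        = of_nat (i + j choose i) * coeff (A $ r $ s) (i + j))"
    by (simp add: subst2_def matrix_matrix_mult_def coeff_sum coeff_subst_mult coeff_subst_add)
      blast
  finally show "subst2 indet_T A ** subst2 indet_T' A = subst2 (indet_T + indet_T') A \<longleftrightarrow>
     (\<forall>i j r s. (\<Sum>m\<in>UNIV. coeff (A $ r $ m) i * coeff (A $ m $ s) j)
        = of_nat (i + j choose i) * coeff (A $ r $ s) (i + j))" .
qed

section \<open>Conjugation by constant matrices\<close>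

lemma const_matrix_mult: "const_matrix (P ** Q) = const_matrix P ** const_matrix Q"
  by (simp add: const_matrix_def vec_eq_iff matrix_matrix_mult_def sum_to_poly [symmetric] mult.commute)

lemma const_matrix_mat_1 [simp]: "const_matrix (mat 1) = mat 1"
  by (simp add: const_matrix_def vec_eq_iff mat_def one_pCons)

text \<open>A one-sided inverse of a square matrix over a field is two-sided, and inverses are
  unique; uniqueness pins down the value of \<open>matrix_inv\<close>, which is defined by
  choice.\<close>

lemma matrix_inv_eqI:
  fixes P Q :: "'k::field^'n^'n"
  assumes "P ** Q = mat 1"
  shows "invertible P" "matrix_inv P = Q"
proof -
  have QP: "Q ** P = mat 1"
    using assms matrix_left_right_inverse by blast
  show inv: "invertible P"
    using assms QP by (auto simp: invertible_def)
  have "P ** matrix_inv P = mat 1 \<and> matrix_inv P ** P = mat 1"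
    unfolding matrix_inv_def using someI_ex [OF inv [unfolded invertible_def]] .
  then show "matrix_inv P = Q"
    using QP by (metis matrix_mul_assoc matrix_mul_lid matrix_mul_rid)
qed

text \<open>An explicit pair of mutually inverse matrices replaces \<open>matrix_inv\<close>, so
  that concrete base changes can be checked by computation.\<close>

lemma equivalent_matrix_iff:
  "equivalent_matrix A B \<longleftrightarrow>
     (\<exists>P Q. P ** Q = mat 1 \<and> Q ** P = mat 1 \<and> const_matrix Q ** A ** const_matrix P = B)"
proof
  assume "equivalent_matrix A B"
  then obtain P where P: "invertible P" "const_matrix (matrix_inv P) ** A ** const_matrix P = B"
    by (auto simp: equivalent_matrix_def)
  then obtain Q where Q: "P ** Q = mat 1" "Q ** P = mat 1"
    by (auto simp: invertible_def)
  then show "\<exists>P Q. P ** Q = mat 1 \<and> Q ** P = mat 1 \<and> const_matrix Q ** A ** const_matrix P = B"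
    using P(2) matrix_inv_eqI(2) [OF Q(1)] by blast
next
  assume "\<exists>P Q. P ** Q = mat 1 \<and> Q ** P = mat 1 \<and> const_matrix Q ** A ** const_matrix P = B"
  then show "equivalent_matrix A B"
    unfolding equivalent_matrix_def using matrix_inv_eqI by metis
qed

lemma equivalent_matrix_refl: "equivalent_matrix A A"
  unfolding equivalent_matrix_iff by (intro exI [of _ "mat 1"]) simp

lemma equivalent_matrix_trans:
  assumes "equivalent_matrix A B" "equivalent_matrix B C"
  shows "equivalent_matrix A C"
proof -
  obtain P Q where PQ: "P ** Q = mat 1" "Q ** P = mat 1" "const_matrix Q ** A ** const_matrix P = B"
    using assms(1) by (auto simp: equivalent_matrix_iff)
  obtain R S where RS: "R ** S = mat 1" "S ** R = mat 1" "const_matrix S ** B ** const_matrix R = C"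
    using assms(2) by (auto simp: equivalent_matrix_iff)
  have "(P ** R) ** (S ** Q) = mat 1" "(S ** Q) ** (P ** R) = mat 1"
    by (metis PQ RS matrix_mul_assoc matrix_mul_rid)+
  moreover have "const_matrix (S ** Q) ** A ** const_matrix (P ** R) = C"
    unfolding const_matrix_mult PQ(3) [symmetric] RS(3) [symmetric] by (simp only: matrix_mul_assoc)
  ultimately show ?thesis
    unfolding equivalent_matrix_iff by blast
qed

definition coeff_matrix :: "'k::field poly^'n^'m \<Rightarrow> nat \<Rightarrow> 'k^'n^'m" where
  "coeff_matrix A i = map_matrix (\<lambda>f. coeff f i) A"

lemma coeff_matrix_nth [simp]: "coeff_matrix A i $ r $ s = coeff (A $ r $ s) i"
  by (simp add: coeff_matrix_def)

lemma coeff_matrix_conj: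
  "coeff_matrix (const_matrix Q ** A ** const_matrix P) i = Q ** coeff_matrix A i ** P"
  by (simp add: vec_eq_iff const_matrix_def matrix_matrix_mult_def coeff_sum mult.commute)

lemma exponential_matrix_coeff_matrix:
  "exponential_matrix A \<longleftrightarrow> coeff_matrix A 0 = mat 1 \<and>
     (\<forall>i j. coeff_matrix A i ** coeff_matrix A j = map_matrix ((*) (of_nat (i + j choose i))) (coeff_matrix A (i + j)))"
  unfolding exponential_matrix_coeff
  by (simp add: vec_eq_iff mat_def matrix_matrix_mult_def)

lemma conj_mult:
  fixes P Q X Y :: "'a::semiring_1^'n^'n"
  assumes "P ** Q = mat 1"
  shows "(Q ** X ** P) ** (Q ** Y ** P) = Q ** (X ** Y) ** P"
proof -
  have "(Q ** X ** P) ** (Q ** Y ** P) = Q ** X ** (P ** Q) ** Y ** P"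
    by (simp only: matrix_mul_assoc)
  then show ?thesis
    by (simp only: assms matrix_mul_rid matrix_mul_assoc)
qed

text \<open>Conjugation acts on each coefficient matrix separately and is linear and multiplicative,
  so it preserves the relations between them.\<close>

lemma equivalent_matrix_exponential:
  assumes "equivalent_matrix A B" "exponential_matrix A"
  shows "exponential_matrix B"
proof -
  obtain P Q where PQ: "P ** Q = mat 1" "Q ** P = mat 1" and B: "const_matrix Q ** A ** const_matrix P = B"
    using assms(1) by (auto simp: equivalent_matrix_iff)
  have "Q ** map_matrix ((*) c) X ** P = map_matrix ((*) c) (Q ** X ** P)" for c X
    by (simp add: vec_eq_iff matrix_matrix_mult_def sum_distrib_left
        sum_distrib_right mult_ac)
  then show ?thesis
    using assms(2) PQ
    by (simp add: exponential_matrix_coeff_matrix B [symmetric] coeff_matrix_conj conj_mult)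
qed

section \<open>Triangularization\<close>

lemma vector_4 [simp]:
  "(vector [w, x, y, z] :: 'a::zero^4) $ 1 = w"
  "(vector [w, x, y, z] :: 'a::zero^4) $ 2 = x"
  "(vector [w, x, y, z] :: 'a::zero^4) $ 3 = y"
  "(vector [w, x, y, z] :: 'a::zero^4) $ 4 = z"
  unfolding vector_def by simp_all

lemma coeff_matrix_eventually_0:
  fixes A :: "'k::field poly^'n^'m"
  shows "\<exists>D. \<forall>i>D. coeff_matrix A i = 0"
proof (intro exI allI impI)
  fix i assume i: "(\<Sum>r\<in>UNIV. \<Sum>s\<in>UNIV. degree (A $ r $ s)) < i"
  show "coeff_matrix A i = 0"
  proof -
    have "degree (A $ r $ s) < i" for r s
    proof -
      have "degree (A $ r $ s) \<le> (\<Sum>s\<in>UNIV. degree (A $ r $ s))"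
        by (rule member_le_sum) auto
      also have "\<dots> \<le> (\<Sum>r\<in>UNIV. \<Sum>s\<in>UNIV. degree (A $ r $ s))"
        by (rule member_le_sum [where f = "\<lambda>r. \<Sum>s\<in>UNIV. degree (A $ r $ s)"]) auto
      finally show ?thesis using i by simp
    qed
    then show ?thesis by (simp add: vec_eq_iff coeff_eq_0)
  qed
qed

text \<open>Since \<open>A\<^sub>j A\<^sub>i\<close> is a multiple of \<open>A\<^sub>i\<^sub>+\<^sub>j\<close>, one can take \<open>A\<^sub>i u\<close> for the last \<open>i\<close> with \<open>A\<^sub>i u \<notin> U\<close>.\<close>

lemma exponential_matrix_fixed_vector_mod:
  fixes A :: "'k::field poly^'n^'n"
  assumes "exponential_matrix A" "vec.subspace U" "U \<noteq> UNIV"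
  obtains v where "v \<notin> U" "\<And>j. j \<ge> 1 \<Longrightarrow> coeff_matrix A j *v v \<in> U"
proof -
  obtain u where u: "u \<notin> U"
    using assms(3) by auto
  obtain D where D: "\<And>i. i > D \<Longrightarrow> coeff_matrix A i = 0"
    using coeff_matrix_eventually_0 by blast
  define S where "S = {i. coeff_matrix A i *v u \<notin> U}"
  have A0: "coeff_matrix A 0 = mat 1"
    and AA: "coeff_matrix A i ** coeff_matrix A j
      = map_matrix ((*) (of_nat (i + j choose i))) (coeff_matrix A (i + j))" for i j
    using assms(1) by (auto simp: exponential_matrix_coeff_matrix)
  have "S \<subseteq> {..D}"
    using D vec.subspace_0 [OF assms(2)] by (force simp: S_def not_less [symmetric])
  then have fin: "finite S"
    by (rule finite_subset) simp
  moreover have "0 \<in> S"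
    using u by (simp add: S_def A0)
  ultimately have "Max S \<in> S"
    by (intro Max_in) auto
  moreover have "coeff_matrix A j *v (coeff_matrix A (Max S) *v u) \<in> U" if "j \<ge> 1" for j
  proof -
    have "map_matrix ((*) c) M *v u = c *s (M *v u)" for c and M :: "'k^'n^'n"
      by (simp add: vec_eq_iff matrix_vector_mult_def sum_distrib_left mult.assoc)
    moreover have "j + Max S \<notin> S"
      using Max_ge [OF fin, of "j + Max S"] that by auto
    ultimately show ?thesis
      by (simp add: matrix_vector_mul_assoc AA S_def vec.subspace_scale [OF assms(2)])
  qed
  ultimately show ?thesis
    using that [of "coeff_matrix A (Max S) *v u"] by (auto simp: S_def)
qed

text \<open>A dimension count; it guarantees that the flag built below can be extended at each
  stage.\<close>

lemma vec_span_ne_UNIV: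
  fixes S :: "('k::field^'n) set"
  assumes "finite S" "card S < CARD('n)"
  shows "vec.span S \<noteq> UNIV"
proof
  assume "vec.span S = UNIV"
  then have "vec.dim (UNIV :: ('k^'n) set) \<le> card S"
    using vec.dim_le_card [of UNIV S] assms(1) by simp
  then show False
    using assms(2) by (simp add: vec.dim_UNIV card_cart_basis vec_dim_card)
qed

text \<open>Four vectors are chosen in turn, each sent by all coefficients of positive index into
  the span of its predecessors. In the basis they form, these coefficients are strictly upper
  triangular.\<close>

lemma exponential_matrix_unitriangular:
  fixes A :: "'k::field poly^4^4"
  assumes "exponential_matrix A"
  obtains a12 a13 a14 a23 a24 a34 where
    "equivalent_matrix A (vector [vector [1, a12, a13, a14], vector [0, 1, a23, a24],
       vector [0, 0, 1, a34], vector [0, 0, 0, 1]])"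
proof -
  obtain v1 where v1: "v1 \<notin> vec.span {}" "\<And>j. j \<ge> 1 \<Longrightarrow> coeff_matrix A j *v v1 \<in> vec.span {}"
    using exponential_matrix_fixed_vector_mod [OF assms vec.subspace_span, of "{}"]
      vec_span_ne_UNIV [of "{}"] by auto
  obtain v2 where v2: "v2 \<notin> vec.span {v1}" "\<And>j. j \<ge> 1 \<Longrightarrow> coeff_matrix A j *v v2 \<in> vec.span {v1}"
    using exponential_matrix_fixed_vector_mod [OF assms vec.subspace_span, of "{v1}"]
      vec_span_ne_UNIV [of "{v1}"] by auto
  have "card {v2, v1} < CARD(4)"
    by (rule le_less_trans [OF card_insert_le_m1]) auto
  then obtain v3 where v3: "v3 \<notin> vec.span {v2, v1}"
      "\<And>j. j \<ge> 1 \<Longrightarrow> coeff_matrix A j *v v3 \<in> vec.span {v2, v1}"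
    using exponential_matrix_fixed_vector_mod [OF assms vec.subspace_span, of "{v2, v1}"]
      vec_span_ne_UNIV [of "{v2, v1}"] by auto
  have "card {v3, v2, v1} < CARD(4)"
    by (intro le_less_trans [OF card_insert_le_m1 [where n = 3]] card_insert_le_m1) auto
  then obtain v4 where v4: "v4 \<notin> vec.span {v3, v2, v1}"
      "\<And>j. j \<ge> 1 \<Longrightarrow> coeff_matrix A j *v v4 \<in> vec.span {v3, v2, v1}"
    using exponential_matrix_fixed_vector_mod [OF assms vec.subspace_span, of "{v3, v2, v1}"]
      vec_span_ne_UNIV [of "{v3, v2, v1}"] by auto
  \<comment> \<open>\<open>vector\<close> lists rows, while the chosen basis has to form the columns
    of \<open>P\<close>.\<close>
  define P where "P = transpose (vector [v1, v2, v3, v4] :: 'k^4^4)"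
  have cols: "column 1 P = v1" "column 2 P = v2" "column 3 P = v3" "column 4 P = v4"
    by (simp_all add: P_def column_transpose row_def)
  have "vec.independent {v4, v3, v2, v1}"
    using v1(1) v2(1) v3(1) v4(1) by (simp add: vec.independent_insert)
  moreover have "card {v4, v3, v2, v1} = 4"
    using v2(1) v3(1) v4(1) by (auto simp: card_insert_if vec.span_base)
  moreover have "vec.dim (UNIV :: ('k^4) set) = 4"
    by (simp only: vec_dim_card) simp
  ultimately have "UNIV \<subseteq> vec.span {v4, v3, v2, v1}"
    by (metis vec.card_ge_dim_independent order_refl subset_UNIV)
  then have "vec.span {v4, v3, v2, v1} = UNIV"
    by blast
  moreover have "columns P = {v4, v3, v2, v1}"
    using cols by (force simp: columns_def UNIV_4 set_eq_iff)
  ultimately obtain Q where Q: "P ** Q = mat 1" "Q ** P = mat 1"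
    using matrix_right_invertible_span_columns [of P] matrix_left_right_inverse [of P] by auto
  define B where "B = const_matrix Q ** A ** const_matrix P"
  have equiv: "equivalent_matrix A B"
    using Q by (auto simp: equivalent_matrix_iff B_def)
  \<comment> \<open>As \<open>Q\<close> inverts \<open>P\<close>, the vector \<open>Q *v w\<close>
    holds the coordinates of \<open>w\<close> in the basis of columns of \<open>P\<close>; those
    outside \<open>T\<close> vanish on the span indexed by \<open>T\<close>.\<close>
  have zero: "(Q *v w) $ r = 0" if "w \<in> vec.span ((\<lambda>s. column s P) ` T)" "r \<notin> T" for w r T
  proof -
    have "vec.subspace {w. (Q *v w) $ r = 0}"
      by (simp add: vec.subspace_def matrix_vector_right_distrib matrix_vector_mult_scaleR
          vector_scalar_commute)
    moreover have "(Q *v column s P) $ r = 0" if "s \<in> T" for s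
    proof -
      have "(Q *v column s P) $ r = (Q ** P) $ r $ s"
        by (simp add: matrix_vector_mult_def matrix_matrix_mult_def column_def)
      then show ?thesis using that \<open>r \<notin> T\<close> by (auto simp: Q mat_def)
    qed
    ultimately have "vec.span ((\<lambda>s. column s P) ` T) \<subseteq> {w. (Q *v w) $ r = 0}"
      by (intro vec.span_minimal) auto
    then show ?thesis using that by auto
  qed
  have coeff_B: "coeff (B $ r $ s) j = (Q *v (coeff_matrix A j *v column s P)) $ r" for r s j
  proof -
    have "coeff (B $ r $ s) j = (Q ** (coeff_matrix A j ** P)) $ r $ s"
      by (metis B_def coeff_matrix_conj coeff_matrix_nth matrix_mul_assoc)
    then show ?thesis
      by (simp add: matrix_vector_mult_def matrix_matrix_mult_def column_def)
  qed
  have coeff_0: "coeff (B $ r $ s) 0 = (if r = s then 1 else 0)" for r s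
    using equivalent_matrix_exponential [OF equiv assms] by (simp add: exponential_matrix_coeff)
  have entry: "B $ r $ s = (if r = s then 1 else 0)"
    if "\<And>j. j \<ge> 1 \<Longrightarrow> coeff_matrix A j *v column s P \<in> vec.span ((\<lambda>s. column s P) ` T)" "r \<notin> T"
    for r s T
  proof (rule poly_eqI)
    show "coeff (B $ r $ s) j = coeff (if r = s then 1 else 0) j" for j
    proof (cases j)
      case (Suc i)
      then show ?thesis using zero [OF that(1) that(2), of j] by (simp add: coeff_B)
    qed (simp add: coeff_0)
  qed
  have "B $ r $ 1 = (if r = 1 then 1 else 0)" for r
    using entry [of 1 "{}" r] v1(2) by (simp add: cols)
  moreover have "B $ r $ 2 = (if r = 2 then 1 else 0)" if "r \<noteq> 1" for r
    using entry [of 2 "{1}" r] v2(2) that by (simp add: cols)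
  moreover have "B $ r $ 3 = (if r = 3 then 1 else 0)" if "r \<noteq> 1" "r \<noteq> 2" for r
    using entry [of 3 "{2, 1}" r] v3(2) that by (simp add: cols)
  moreover have "B $ r $ 4 = (if r = 4 then 1 else 0)" if "r \<noteq> 1" "r \<noteq> 2" "r \<noteq> 3" for r
    using entry [of 4 "{3, 2, 1}" r] v4(2) that by (simp add: cols)
  ultimately have "B = vector [vector [1, B $ 1 $ 2, B $ 1 $ 3, B $ 1 $ 4],
      vector [0, 1, B $ 2 $ 3, B $ 2 $ 4], vector [0, 0, 1, B $ 3 $ 4], vector [0, 0, 0, 1]]"
    by (simp add: vec_eq_iff forall_4)
  then show ?thesis
    using that equiv by metis
qed

section \<open>Additive polynomials and the logarithm\<close>

lemma p_polynomial_iff: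
  assumes "p \<ge> 2"
  shows "p_polynomial p f \<longleftrightarrow> (\<forall>n. coeff f n \<noteq> 0 \<longrightarrow> (\<exists>k. n = p ^ k))"
proof
  assume "p_polynomial p f"
  then obtain m c where f: "f = (\<Sum>i<m. monom (c i) (p ^ i))"
    by (auto simp: p_polynomial_def)
  show "\<forall>n. coeff f n \<noteq> 0 \<longrightarrow> (\<exists>k. n = p ^ k)"
  proof (intro allI impI)
    fix n assume "coeff f n \<noteq> 0"
    then have "(\<Sum>i<m. if p ^ i = n then c i else 0) \<noteq> 0"
      by (simp add: f coeff_sum)
    then obtain i where "(if p ^ i = n then c i else 0) \<noteq> 0"
      by (rule sum.not_neutral_contains_not_neutral)
    then show "\<exists>k. n = p ^ k" by (auto split: if_splits)
  qed
next
  assume pow: "\<forall>n. coeff f n \<noteq> 0 \<longrightarrow> (\<exists>k. n = p ^ k)"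
  have inj: "p ^ i = p ^ j \<longleftrightarrow> i = j" for i j
    using assms by simp
  \<comment> \<open>Since \<open>k < p ^ k\<close>, every exponent \<open>p ^ k\<close> that occurs
    has \<open>k\<close> at most the degree, so this range is long enough.\<close>
  have "f = (\<Sum>i<Suc (degree f). monom (coeff f (p ^ i)) (p ^ i))"
  proof (rule poly_eqI)
    fix n
    show "coeff f n = coeff (\<Sum>i<Suc (degree f). monom (coeff f (p ^ i)) (p ^ i)) n"
    proof (cases "coeff f n = 0")
      case True
      then show ?thesis by (simp add: coeff_sum cong: if_cong del: sum.lessThan_Suc)
    next
      case False
      then obtain k where k: "n = p ^ k" using pow by blast
      have "k < p ^ k" using assms by (intro power_gt_expt) simp
      then have "k < Suc (degree f)"
        using le_degree [OF False] k by simp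
      then show ?thesis
        by (simp add: coeff_sum k inj del: sum.lessThan_Suc)
    qed
  qed
  then show "p_polynomial p f" unfolding p_polynomial_def
    by (intro exI [of _ "Suc (degree f)"] exI [of _ "\<lambda>i. coeff f (p ^ i)"])
qed

lemma p_polynomial_add:
  assumes "p \<ge> 2" "p_polynomial p f" "p_polynomial p g"
  shows "p_polynomial p (f + g)"
  unfolding p_polynomial_iff [OF assms(1)]
proof (intro allI impI)
  fix n assume "coeff (f + g) n \<noteq> 0"
  then have "coeff f n \<noteq> 0 \<or> coeff g n \<noteq> 0" by auto
  then show "\<exists>k. n = p ^ k"
    using assms(2,3) p_polynomial_iff [OF assms(1)] by blast
qed

lemma p_polynomial_smult:
  assumes "p \<ge> 2" "p_polynomial p f"
  shows "p_polynomial p (smult c f)"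
  using assms by (auto simp: p_polynomial_iff)

lemma p_polynomial_0: "p_polynomial p 0"
  unfolding p_polynomial_def by (intro exI [of _ 0]) simp

text \<open>Write \<open>n = q * m\<close> with \<open>q\<close> the largest power of
  \<open>p\<close> dividing \<open>n\<close>. If \<open>m > 1\<close>, then
  \<open>n choose q\<close> has the same \<open>p\<close>-adic valuation as \<open>m\<close>, namely
  0, so the relation for \<open>q\<close> and \<open>n - q\<close> forces the coefficient at
  \<open>n\<close> to vanish.\<close>

lemma additive_imp_p_polynomial:
  fixes f :: "'k::field poly"
  assumes char: "CHAR('k) = p" and "p > 0" and "coeff f 0 = 0"
    and add: "\<And>i j. i \<ge> 1 \<Longrightarrow> j \<ge> 1 \<Longrightarrow> of_nat (i + j choose i) * coeff f (i + j) = 0"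
  shows "p_polynomial p f"
proof -
  have prime: "prime p"
    using prime_CHAR_semidom [where 'a = 'k] assms(1,2) by simp
  have "\<exists>k. n = p ^ k" if nz: "coeff f n \<noteq> 0" for n
  proof -
    have "n \<noteq> 0" using nz assms(3) by (metis)
    then obtain m where m: "n = p ^ multiplicity p n * m" "\<not> p dvd m"
      using multiplicity_decompose' [of n p] prime not_prime_unit by blast
    have "m > 0" using \<open>n \<noteq> 0\<close> m(1) by (metis gr0I mult_0_right)
    define q where "q = p ^ multiplicity p n"
    have "m = 1"
    proof (rule ccontr)
      assume "m \<noteq> 1"
      have "q > 0" using \<open>p > 0\<close> by (simp add: q_def)
      moreover have "n = q * m" using m by (simp add: q_def)
      ultimately have "q \<ge> 1" "q < n" using \<open>m > 0\<close> \<open>m \<noteq> 1\<close> by auto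
      then have "of_nat (n choose q) = (0 :: 'k)"
        using add [of q "n - q"] nz by simp
      then have "p dvd (n choose q)"
        by (simp add: of_nat_eq_0_iff_char_dvd char)
      moreover have "(n choose q) \<noteq> 0" using \<open>q < n\<close> by simp
      ultimately have "multiplicity p (n choose q) \<noteq> 0"
        using prime not_prime_unit by (metis multiplicity_gt_zero_iff less_irrefl)
      moreover have "multiplicity p (n choose q) = multiplicity p m"
        using const_p_fac [OF \<open>m > 0\<close> prime, of "multiplicity p n"] m(1) by (simp add: q_def)
      ultimately show False using m(2) by (simp add: not_dvd_imp_multiplicity_0)
    qed
    then show ?thesis using m(1) by auto
  qed
  then show ?thesis
    using p_polynomial_iff prime_ge_2_nat [OF prime] by blast
qed

section \<open>Substitution homomorphisms and additivity of the logarithm\<close>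

lemma subst_add:
  "poly (map_poly (\<lambda>c. [:[:c:]:]) (f + g)) s
     = poly (map_poly (\<lambda>c. [:[:c:]:]) f) s + poly (map_poly (\<lambda>c. [:[:c:]:]) g) s"
proof (induction f g rule: poly_induct2)
  case (pCons a f b g)
  have "pCons a f + pCons b g = pCons (a + b) (f + g)" "[:[:a + b:]:] = [:[:a:]:] + [:[:b:]:]"
    by simp_all
  then show ?case
    by (simp only: subst_pCons pCons.IH distrib_left add_ac)
qed simp

lemma subst_smult:
  "poly (map_poly (\<lambda>c. [:[:c:]:]) (smult a f)) s = [:[:a:]:] * poly (map_poly (\<lambda>c. [:[:c:]:]) f) s"
  by (induction f) (simp_all only: smult_pCons subst_pCons, simp_all add: algebra_simps)

lemma subst_mult:
  "poly (map_poly (\<lambda>c. [:[:c:]:]) (f * g)) s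
     = poly (map_poly (\<lambda>c. [:[:c:]:]) f) s * poly (map_poly (\<lambda>c. [:[:c:]:]) g) s"
proof (induction f)
  case (pCons a f)
  then show ?case
    by (simp only: mult_pCons_left subst_add subst_smult subst_pCons) (simp add: algebra_simps)
qed simp

text \<open>Unprimed letters stand for values at \<open>T\<close>, primed ones for values at
  \<open>T'\<close>, and \<open>h\<close> for 1/2. This gives additivity of the logarithm's entries
  (1,3) and (2,4): commutation lets the correction term absorb the cross term
  \<open>x * y'\<close>.\<close>

lemma log_entry_add:
  fixes x :: "'a::comm_ring_1"
  assumes "2 * h = 1" "x * y' = x' * y"
  shows "(u + h * (x * y)) + x * y' + (u' + h * (x' * y')) - h * ((x + x') * (y + y')) = u + u'"
    (is "?L = _")
proof -
  have "?L = u + u' + (1 - 2 * h) * (x * y') + h * (x * y' - x' * y)"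
    by (simp add: algebra_simps)
  then show ?thesis by (simp add: assms)
qed

text \<open>The same for the entry (1,4), with \<open>g\<close> for 1/6. Besides commutation it
  rests on \<open>h = 3 * g\<close>, which balances the quadratic and cubic corrections.\<close>

lemma log_corner_add:
  fixes x :: "'a::comm_ring_1"
  assumes "2 * h = 1" "6 * g = 1" "x * y' = x' * y" "y * z' = y' * z"
    and "x * v' + u * z' = x' * v + u' * z"
  shows "(w + h * (x * v + u * z) + g * (x * y * z))
     + x * (v' + h * (y' * z')) + (u + h * (x * y)) * z'
     + (w' + h * (x' * v' + u' * z') + g * (x' * y' * z'))
     - h * ((x + x') * (v + v') + (u + u') * (z + z')) - g * ((x + x') * (y + y') * (z + z')) = w + w'"
    (is "?L = _")
proof -
  have "h = h * (6 * g)" by (simp add: assms)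
  also have "\<dots> = (2 * h) * (3 * g)" by (simp add: algebra_simps)
  finally have "h - 3 * g = 0" by (simp add: assms)
  \<comment> \<open>Each summand beyond \<open>w + w'\<close> is grouped around a factor that
    vanishes by hypothesis.\<close>
  moreover have "?L = w + w' + (1 - 2 * h) * (x * v' + u * z')
      + h * ((x * v' + u * z') - (x' * v + u' * z))
      + (h - 3 * g) * (x * y * z' + x * y' * z')
      + g * ((2 * x + x') * (y * z' - y' * z) + (z + 2 * z') * (x * y' - x' * y))"
    by (simp add: algebra_simps)
  ultimately show ?thesis by (simp add: assms)
qed

text \<open>\<open>A(T)\<close> and \<open>A(T')\<close> commute because both products equal
  \<open>A(T + T')\<close>; on coefficients this is the symmetry of binomial coefficients.\<close>

lemma exponential_matrix_subst_commute:
  fixes A :: "'k::field poly^'n^'n"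
  assumes "exponential_matrix A"
  defines "S \<equiv> \<lambda>f :: 'k poly. poly (map_poly (\<lambda>c. [:[:c:]:]) f) indet_T"
    and "S' \<equiv> \<lambda>f :: 'k poly. poly (map_poly (\<lambda>c. [:[:c:]:]) f) indet_T'"
  shows "(\<Sum>m\<in>UNIV. S (A $ r $ m) * S' (A $ m $ s)) = (\<Sum>m\<in>UNIV. S' (A $ r $ m) * S (A $ m $ s))"
proof -
  have "(\<Sum>m\<in>UNIV. coeff (A $ r $ m) i * coeff (A $ m $ s) j)
      = (\<Sum>m\<in>UNIV. coeff (A $ r $ m) j * coeff (A $ m $ s) i)" for i j
    using assms(1) by (simp add: exponential_matrix_coeff add.commute [of i j] binomial_symmetric [of j "j + i"])
  then show ?thesis
    by (simp add: poly_eq_iff coeff_sum S_def S'_def coeff_subst_mult)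
       (simp add: mult.commute [of "poly _ indet_T'"] coeff_subst_mult mult.commute)
qed

text \<open>The arguments run diagonal by diagonal: superdiagonal, second diagonal, corner.\<close>

definition strict_upper :: "'a::zero \<Rightarrow> 'a \<Rightarrow> 'a \<Rightarrow> 'a \<Rightarrow> 'a \<Rightarrow> 'a \<Rightarrow> 'a^4^4" where
  "strict_upper x y z u v w =
     vector [vector [0, x, u, w], vector [0, 0, y, v], vector [0, 0, 0, z], vector [0, 0, 0, 0]]"

text \<open>Truncated exponential series, adequate because the fourth power of a \<open>strict_upper\<close> vanishes.\<close>

definition exp_matrix :: "'k::field poly^'n^'n \<Rightarrow> 'k poly^'n^'n" where
  "exp_matrix N = mat 1 + N + map_matrix (smult (1/2)) (N ** N)
     + map_matrix (smult (1/6)) (N ** N ** N)"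

lemma exp_matrix_strict_upper:
  "exp_matrix (strict_upper x y z u v w) =
     vector [vector [1, x, u + smult (1/2) (x * y),
                     w + smult (1/2) (x * v + u * z) + smult (1/6) (x * y * z)],
             vector [0, 1, y, v + smult (1/2) (y * z)],
             vector [0, 0, 1, z],
             vector [0, 0, 0, 1]]"
  by (simp add: exp_matrix_def strict_upper_def vec_eq_iff forall_4 mat_def
      matrix_matrix_mult_def sum_4)

text \<open>Solving \<open>A = exp N\<close> one diagonal at a time determines \<open>N\<close>. As
  \<open>A(T)\<close> and \<open>A(T')\<close> commute, so do \<open>N(T)\<close> and
  \<open>N(T')\<close>, and the logarithm of the product is the sum of the logarithms; hence the
  entries of \<open>N\<close> are additive.\<close>

lemma exponential_matrix_log:
  fixes a12 :: "'k::field poly"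
  assumes char: "CHAR('k) = p" and p: "p \<ge> 5"
    and A: "A = vector [vector [1, a12, a13, a14], vector [0, 1, a23, a24],
       vector [0, 0, 1, a34], vector [0, 0, 0, 1]]"
    and exp: "exponential_matrix A"
  obtains x y z u v w where "A = exp_matrix (strict_upper x y z u v w)"
    "\<forall>f\<in>{x, y, z, u, v, w}. p_polynomial p f"
    "\<And>i j. coeff x i * coeff y j = coeff x j * coeff y i"
    "\<And>i j. coeff y i * coeff z j = coeff y j * coeff z i"
    "\<And>i j. coeff x i * coeff v j + coeff u i * coeff z j
         = coeff x j * coeff v i + coeff u j * coeff z i"
proof -
  define x y z where "x = a12" and "y = a23" and "z = a34"
  define u where "u = a13 - smult (1/2) (x * y)"
  define v where "v = a24 - smult (1/2) (y * z)"
  define w where "w = a14 - smult (1/2) (x * v + u * z) - smult (1/6) (x * y * z)"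
  have a: "a12 = x" "a23 = y" "a34 = z" "a13 = u + smult (1/2) (x * y)"
    "a24 = v + smult (1/2) (y * z)"
    "a14 = w + smult (1/2) (x * v + u * z) + smult (1/6) (x * y * z)"
    by (simp_all add: x_def y_def z_def u_def v_def w_def)
  have A_exp: "A = exp_matrix (strict_upper x y z u v w)"
    unfolding exp_matrix_strict_upper A a ..

  \<comment> \<open>\<open>S\<close>, \<open>S'\<close> and \<open>D\<close> send \<open>T\<close>
    to \<open>T\<close>, \<open>T'\<close> and \<open>T + T'\<close>; additivity of \<open>f\<close>
    reads \<open>D f = S f + S' f\<close>.\<close>
  define S :: "'k poly \<Rightarrow> 'k poly poly" where
    "S = (\<lambda>f. poly (map_poly (\<lambda>c. [:[:c:]:]) f) indet_T)"
  define S' :: "'k poly \<Rightarrow> 'k poly poly" where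
    "S' = (\<lambda>f. poly (map_poly (\<lambda>c. [:[:c:]:]) f) indet_T')"
  define D :: "'k poly \<Rightarrow> 'k poly poly" where
    "D = (\<lambda>f. poly (map_poly (\<lambda>c. [:[:c:]:]) f) (indet_T + indet_T'))"
  define h g :: "'k poly poly" where "h = [:[:1/2:]:]" and "g = [:[:1/6:]:]"
  have hom: "S 0 = 0" "S 1 = 1" "S' 0 = 0" "S' 1 = 1" "D 0 = 0" "D 1 = 1"
    "S (a + b) = S a + S b" "S' (a + b) = S' a + S' b" "D (a + b) = D a + D b"
    "S (a * b) = S a * S b" "S' (a * b) = S' a * S' b" "D (a * b) = D a * D b"
    "S (smult (1/2) a) = h * S a" "S' (smult (1/2) a) = h * S' a" "D (smult (1/2) a) = h * D a"
    "S (smult (1/6) a) = g * S a" "S' (smult (1/6) a) = g * S' a" "D (smult (1/6) a) = g * D a"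
    for a b
    by (simp_all only: S_def S'_def D_def h_def g_def subst_add subst_mult subst_smult)
       (simp_all add: one_pCons map_poly_pCons)
  have mult: "(\<Sum>m\<in>UNIV. S (A $ r $ m) * S' (A $ m $ s)) = D (A $ r $ s)" for r s
    using exp by (simp add: exponential_matrix_def subst2_def vec_eq_iff matrix_matrix_mult_def
        S_def S'_def D_def)
  have commute: "(\<Sum>m\<in>UNIV. S (A $ r $ m) * S' (A $ m $ s))
      = (\<Sum>m\<in>UNIV. S' (A $ r $ m) * S (A $ m $ s))" for r s
    unfolding S_def S'_def using exp by (rule exponential_matrix_subst_commute)

  have "\<not> p dvd 2"
    using p by (auto dest: dvd_imp_le)
  then have two: "(2::'k) \<noteq> 0"
    using of_nat_eq_0_iff_char_dvd [where 'a = 'k, of 2] char by simp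
  have "prime p"
    using prime_CHAR_semidom [where 'a = 'k] char p by simp
  moreover have "\<not> p dvd 3"
    using p by (auto dest: dvd_imp_le)
  ultimately have "\<not> p dvd 2 * 3"
    using \<open>\<not> p dvd 2\<close> prime_dvd_mult_iff by blast
  then have six: "(6::'k) \<noteq> 0"
    using of_nat_eq_0_iff_char_dvd [where 'a = 'k, of 6] char by simp
  have h: "2 * h = 1" and g: "6 * g = 1"
    using two six by (simp_all add: h_def g_def numeral_poly one_pCons)

  have Dx: "D x = S x + S' x" and Dy: "D y = S y + S' y" and Dz: "D z = S z + S' z"
    using mult [of 1 2] mult [of 2 3] mult [of 3 4] by (simp_all add: A a sum_4 hom add.commute)
  have xy: "S x * S' y = S' x * S y" and yz: "S y * S' z = S' y * S z"
    using commute [of 1 3] commute [of 2 4] by (simp_all add: A a sum_4 hom algebra_simps)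
  have xv: "S x * S' v + S u * S' z = S' x * S v + S' u * S z"
  proof -
    have 1: "S x * (S' v + h * (S' y * S' z)) + (S u + h * (S x * S y)) * S' z
        = S' x * (S v + h * (S y * S z)) + (S' u + h * (S' x * S' y)) * S z"
      using commute [of 1 4] by (simp add: A a sum_4 hom algebra_simps)
    \<comment> \<open>The difference between the commutation relation for \<open>A\<close> and the
      one for its logarithm is a combination of the relations \<open>xy\<close> and
      \<open>yz\<close>.\<close>
    have "(S x * S' v + S u * S' z) - (S' x * S v + S' u * S z)
        = (S x * (S' v + h * (S' y * S' z)) + (S u + h * (S x * S y)) * S' z)
          - (S' x * (S v + h * (S y * S z)) + (S' u + h * (S' x * S' y)) * S z)
          - h * ((S x + S' x) * (S y * S' z - S' y * S z)
               + (S z + S' z) * (S x * S' y - S' x * S y))"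
      by (simp add: algebra_simps)
    then show ?thesis by (simp add: 1 xy yz)
  qed
  have Du: "D u = S u + S' u"
  proof -
    have "D u + h * (D x * D y) = (S u + h * (S x * S y)) + S x * S' y + (S' u + h * (S' x * S' y))"
      using mult [of 1 3] by (simp add: A a sum_4 hom add_ac)
    then show ?thesis
      using log_entry_add [OF h xy, of "S u" "S' u"] by (simp add: Dx Dy algebra_simps)
  qed
  have Dv: "D v = S v + S' v"
  proof -
    have "D v + h * (D y * D z) = (S v + h * (S y * S z)) + S y * S' z + (S' v + h * (S' y * S' z))"
      using mult [of 2 4] by (simp add: A a sum_4 hom add_ac)
    then show ?thesis
      using log_entry_add [OF h yz, of "S v" "S' v"] by (simp add: Dy Dz algebra_simps)
  qed
  have Dw: "D w = S w + S' w"
  proof -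
    have "D w + g * (D x * D y * D z) + h * (D x * D v + D u * D z)
        = (S w + h * (S x * S v + S u * S z) + g * (S x * S y * S z))
     + S x * (S' v + h * (S' y * S' z)) + (S u + h * (S x * S y)) * S' z
     + (S' w + h * (S' x * S' v + S' u * S' z) + g * (S' x * S' y * S' z))"
      using mult [of 1 4] by (simp add: A a sum_4 hom add_ac)
    then show ?thesis
      unfolding log_corner_add [OF h g xy yz xv, of "S w" "S' w", symmetric]
      by (simp only: Dx Dy Dz Du Dv eq_diff_eq)
  qed

  have p_poly: "p_polynomial p f" if "D f = S f + S' f" for f
  proof -
    \<comment> \<open>The right-hand side has no mixed monomials, so the equation kills the case of
      positive \<open>i\<close> and \<open>j\<close>, and at \<open>i = j = 0\<close> it gives
      \<open>coeff f 0 = 0\<close>.\<close>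
    have eq: "of_nat (i + j choose i) * coeff f (i + j)
        = (if j = 0 then coeff f i else 0) + (if i = 0 then coeff f j else 0)" for i j
      using arg_cong [OF that, of "\<lambda>q. coeff (coeff q j) i"]
      by (simp add: D_def S_def S'_def coeff_subst_add subst_indet_T subst_indet_T' coeff_map_poly
          coeff_pCons' split: if_splits nat.splits)
    show ?thesis
    proof (rule additive_imp_p_polynomial [OF char])
      have "coeff f 0 = coeff f 0 + coeff f 0"
        using eq [of 0 0] by (simp only: simp_thms if_True add_0 binomial_n_0 of_nat_1 mult_1_left)
      then show "coeff f 0 = 0"
        by (simp only: add_cancel_right_right)
      show "of_nat (i + j choose i) * coeff f (i + j) = 0" if "i \<ge> 1" "j \<ge> 1" for i j
        using eq [of i j] that by simp
    qed (use p in simp)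
  qed
  have coeffs: "coeff (coeff (S a * S' b) j) i = coeff a i * coeff b j"
    "coeff (coeff (S' a * S b) j) i = coeff a j * coeff b i" for a b i j
    using coeff_subst_mult [of a b j i] coeff_subst_mult [of b a j i]
    by (simp_all add: S_def S'_def mult.commute)
  show ?thesis
  proof (rule that [OF A_exp])
    show "\<forall>f\<in>{x, y, z, u, v, w}. p_polynomial p f"
      using p_poly Dx Dy Dz Du Dv Dw by blast
    fix i j
    show "coeff x i * coeff y j = coeff x j * coeff y i"
      using arg_cong [OF xy, of "\<lambda>q. coeff (coeff q j) i"] by (simp only: coeffs)
    show "coeff y i * coeff z j = coeff y j * coeff z i"
      using arg_cong [OF yz, of "\<lambda>q. coeff (coeff q j) i"] by (simp only: coeffs)
    show "coeff x i * coeff v j + coeff u i * coeff z j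
         = coeff x j * coeff v i + coeff u j * coeff z i"
      using arg_cong [OF xv, of "\<lambda>q. coeff (coeff q j) i"] by (simp only: coeffs coeff_add)
  qed
qed

section \<open>Classification of the logarithms\<close>

text \<open>The last three conditions say that the coefficient matrices of \<open>strict_upper x y z u v w\<close> commute.\<close>

definition commuting_log :: "nat \<Rightarrow> 'k::field poly \<Rightarrow> 'k poly \<Rightarrow> 'k poly \<Rightarrow> 'k poly \<Rightarrow> 'k poly \<Rightarrow> 'k poly \<Rightarrow> bool"
  where
  "commuting_log p x y z u v w \<longleftrightarrow>
     (\<forall>f\<in>{x, y, z, u, v, w}. p_polynomial p f) \<and>
     (\<forall>i j. coeff x i * coeff y j = coeff x j * coeff y i) \<and>
     (\<forall>i j. coeff y i * coeff z j = coeff y j * coeff z i) \<and>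
     (\<forall>i j. coeff x i * coeff v j + coeff u i * coeff z j
        = coeff x j * coeff v i + coeff u j * coeff z i)"

text \<open>The logarithms of the seven normal forms, in the order of the theorem; \<open>l\<close>,
  \<open>m\<close>, \<open>n\<close> are the entries of the symmetric 2 by 2 matrix in the last
  one.\<close>

definition canonical_log :: "nat \<Rightarrow> 'k::field poly^4^4 \<Rightarrow> bool" where
  "canonical_log p N \<longleftrightarrow>
     (\<exists>a b c. p_polynomial p a \<and> p_polynomial p b \<and> p_polynomial p c \<and> a \<noteq> 0 \<and>
        N = strict_upper a a a b b c)
   \<or> (\<exists>a b c. p_polynomial p a \<and> p_polynomial p b \<and> p_polynomial p c \<and> a \<noteq> 0 \<and>
        N = strict_upper a a 0 b 0 c)
   \<or> (\<exists>a b c. p_polynomial p a \<and> p_polynomial p b \<and> p_polynomial p c \<and> a \<noteq> 0 \<and>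
        N = strict_upper 0 a a 0 b c)
   \<or> (\<exists>a b c. p_polynomial p a \<and> p_polynomial p b \<and> p_polynomial p c \<and>
        N = strict_upper a 0 0 b 0 c)
   \<or> (\<exists>a b c d. p_polynomial p a \<and> p_polynomial p b \<and> p_polynomial p c \<and> p_polynomial p d \<and>
        N = strict_upper 0 c 0 a d b)
   \<or> (\<exists>a b c. p_polynomial p a \<and> p_polynomial p b \<and> p_polynomial p c \<and>
        N = strict_upper 0 0 c 0 b a)
   \<or> (\<exists>a b c l m n. p_polynomial p a \<and> p_polynomial p b \<and> p_polynomial p c \<and>
        lin_indep_pair a b \<and> l * n - m^2 \<noteq> 0 \<and>
        N = strict_upper a 0 (smult m a + smult n b) b (smult l a + smult m b) c)"

section \<open>Base changes acting on logarithms\<close>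

lemma smult_sum_right: "smult c (\<Sum>i\<in>S. f i) = (\<Sum>i\<in>S. smult c (f i))"
  by (induction S rule: infinite_finite_induct) (simp_all add: smult_add_right)

text \<open>\<open>exp_matrix N\<close> is a polynomial in \<open>N\<close> with scalar
  coefficients, so conjugation passes through it; classifying logarithms is therefore
  enough.\<close>

lemma exp_matrix_equivalent:
  assumes "equivalent_matrix N N'"
  shows "equivalent_matrix (exp_matrix N) (exp_matrix N')"
proof -
  obtain P Q where PQ: "P ** Q = mat 1" "Q ** P = mat 1"
    and N': "const_matrix Q ** N ** const_matrix P = N'"
    using assms by (auto simp: equivalent_matrix_iff)
  define C where "C X = const_matrix Q ** X ** const_matrix P" for X
  have inv: "const_matrix P ** const_matrix Q = mat 1" "const_matrix Q ** const_matrix P = mat 1"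
    using PQ by (simp_all flip: const_matrix_mult)
  have C_mult: "C (X ** Y) = C X ** C Y" for X Y
    by (simp only: C_def conj_mult [OF inv(1)])
  have C_add: "C (X + Y) = C X + C Y" for X Y
    by (simp add: C_def vec_eq_iff matrix_matrix_mult_def distrib_left distrib_right sum.distrib)
  have C_smult: "C (map_matrix (smult c) X) = map_matrix (smult c) (C X)" for c X
    by (simp add: C_def vec_eq_iff matrix_matrix_mult_def flip: smult_sum_right)
  have "C (mat 1) = mat 1"
    by (simp add: C_def inv)
  then have "C (exp_matrix N) = exp_matrix N'"
    by (simp add: exp_matrix_def C_mult C_add C_smult N' [folded C_def])
  then show ?thesis
    using PQ by (auto simp: equivalent_matrix_iff C_def)
qed

lemma strict_upper_diag:
  fixes x :: "'k::field poly"
  assumes "d1 \<noteq> 0" "d2 \<noteq> 0" "d3 \<noteq> 0" "d4 \<noteq> 0"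
  shows "equivalent_matrix (strict_upper x y z u v w)
    (strict_upper (smult (d2/d1) x) (smult (d3/d2) y) (smult (d4/d3) z)
       (smult (d3/d1) u) (smult (d4/d2) v) (smult (d4/d1) w))"
  unfolding equivalent_matrix_iff
proof (intro exI conjI)
  let ?P = "vector [vector [d1, 0, 0, 0], vector [0, d2, 0, 0],
      vector [0, 0, d3, 0], vector [0, 0, 0, d4]] :: 'k^4^4"
  let ?Q = "vector [vector [1/d1, 0, 0, 0], vector [0, 1/d2, 0, 0],
      vector [0, 0, 1/d3, 0], vector [0, 0, 0, 1/d4]] :: 'k^4^4"
  show "?P ** ?Q = mat 1" "?Q ** ?P = mat 1"
    using assms by (simp_all add: vec_eq_iff forall_4 mat_def matrix_matrix_mult_def sum_4)
  show "const_matrix ?Q ** strict_upper x y z u v w ** const_matrix ?P =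
    strict_upper (smult (d2/d1) x) (smult (d3/d2) y) (smult (d4/d3) z)
       (smult (d3/d1) u) (smult (d4/d2) v) (smult (d4/d1) w)"
    by (simp add: const_matrix_def strict_upper_def vec_eq_iff forall_4 matrix_matrix_mult_def sum_4)
qed

text \<open>With entry (2,3) zero, the middle two basis vectors may be changed by any matrix of
  determinant \<open>e\<close>: it acts on the row \<open>(x, u)\<close> from the right, its inverse
  on the column \<open>(v, z)\<close> from the left.\<close>

lemma strict_upper_block:
  fixes x :: "'k::field poly"
  assumes "a * d - b * c = e" "e \<noteq> 0"
  shows "equivalent_matrix (strict_upper x 0 z u v w)
    (strict_upper (smult a x + smult c u) 0 (smult (a/e) z - smult (c/e) v)
       (smult b x + smult d u) (smult (d/e) v - smult (b/e) z) w)"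
  unfolding equivalent_matrix_iff
proof (intro exI conjI)
  let ?P = "vector [vector [1, 0, 0, 0], vector [0, a, b, 0],
      vector [0, c, d, 0], vector [0, 0, 0, 1]] :: 'k^4^4"
  let ?Q = "vector [vector [1, 0, 0, 0], vector [0, d/e, -b/e, 0],
      vector [0, -c/e, a/e, 0], vector [0, 0, 0, 1]] :: 'k^4^4"
  show "?P ** ?Q = mat 1" "?Q ** ?P = mat 1"
    using assms by (auto simp: vec_eq_iff forall_4 mat_def matrix_matrix_mult_def sum_4 field_simps)
  show "const_matrix ?Q ** strict_upper x 0 z u v w ** const_matrix ?P =
    strict_upper (smult a x + smult c u) 0 (smult (a/e) z - smult (c/e) v)
       (smult b x + smult d u) (smult (d/e) v - smult (b/e) z) w"
    by (simp add: const_matrix_def strict_upper_def vec_eq_iff forall_4 matrix_matrix_mult_def sum_4)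
qed

text \<open>Elementary matrices in positions (2,3), (3,4) and (1,2). All preserve the superdiagonal;
  the first serves to balance \<open>u\<close> against \<open>v\<close>, the others to clear
  \<open>v\<close> or \<open>u\<close> when it is a multiple of \<open>y\<close>.\<close>

lemma strict_upper_shear:
  fixes x :: "'k::field poly"
  shows "equivalent_matrix (strict_upper x y z u v w)
    (strict_upper x y z (u + smult s x) (v - smult s z) w)" (is ?t23)
  and "equivalent_matrix (strict_upper x y z u v w)
    (strict_upper x y z u (v + smult s y) (w + smult s u))" (is ?t34)
  and "equivalent_matrix (strict_upper x y z u v w)
    (strict_upper x y z (u - smult s y) v (w - smult s v))" (is ?t12)
proof -
  let ?E = "\<lambda>a b c. vector [vector [1, a, 0, 0], vector [0, 1, b, 0],
      vector [0, 0, 1, c], vector [0, 0, 0, 1]] :: 'k^4^4"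
  note defs = vec_eq_iff forall_4 mat_def matrix_matrix_mult_def sum_4 const_matrix_def strict_upper_def
  show ?t23
    unfolding equivalent_matrix_iff
    by (rule exI [of _ "?E 0 s 0"], rule exI [of _ "?E 0 (-s) 0"]) (simp add: defs one_pCons)
  show ?t34
    unfolding equivalent_matrix_iff
    by (rule exI [of _ "?E 0 0 s"], rule exI [of _ "?E 0 0 (-s)"]) (simp add: defs one_pCons)
  show ?t12
    unfolding equivalent_matrix_iff
    by (rule exI [of _ "?E s 0 0"], rule exI [of _ "?E (-s) 0 0"]) (simp add: defs one_pCons)
qed

text \<open>Exchanging the last two basis vectors brings \<open>v\<close> into position (2,3); the
  vanishing entry (3,4) keeps the matrix upper triangular.\<close>

lemma strict_upper_permute_1243:
  "equivalent_matrix (strict_upper x 0 0 u v w) (strict_upper x v 0 w 0 (u :: 'k::field poly))"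
proof -
  let ?P = "vector [vector [1, 0, 0, 0], vector [0, 1, 0, 0],
      vector [0, 0, 0, 1], vector [0, 0, 1, 0]] :: 'k^4^4"
  show ?thesis
    unfolding equivalent_matrix_iff
    by (rule exI [of _ ?P], rule exI [of _ ?P])
       (simp add: vec_eq_iff forall_4 mat_def matrix_matrix_mult_def sum_4 const_matrix_def strict_upper_def)
qed

text \<open>Moving the third basis vector to the front brings \<open>x\<close> into position (2,3);
  the third column is zero above the diagonal, so the matrix stays upper triangular.\<close>

lemma strict_upper_permute_3124:
  "equivalent_matrix (strict_upper x 0 z 0 v w) (strict_upper 0 x v 0 w (z :: 'k::field poly))"
proof -
  let ?P = "vector [vector [0, 1, 0, 0], vector [0, 0, 1, 0],
      vector [1, 0, 0, 0], vector [0, 0, 0, 1]] :: 'k^4^4"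
  show ?thesis
    unfolding equivalent_matrix_iff
    by (rule exI [of _ ?P], rule exI [of _ "transpose ?P"])
       (simp add: vec_eq_iff forall_4 mat_def matrix_matrix_mult_def sum_4 const_matrix_def
         strict_upper_def transpose_def)
qed

section \<open>Logarithms with nonzero entry (2,3)\<close>

text \<open>All 2 by 2 minors of the two coefficient sequences vanish; the factor is read off at the
  leading coefficient of \<open>g\<close>.\<close>

lemma symmetric_imp_proportional:
  fixes f g :: "'k::field poly"
  assumes "g \<noteq> 0" and sym: "\<And>i j. coeff f i * coeff g j = coeff f j * coeff g i"
  obtains c where "f = smult c g"
proof
  show "f = smult (coeff f (degree g) / lead_coeff g) g"
    using assms(1) sym [of _ "degree g"] by (simp add: poly_eq_iff field_simps)
qed

text \<open>Commutation makes \<open>x\<close> and \<open>z\<close> multiples of \<open>y\<close>,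
  with factors \<alpha> and \<beta>; which of them vanish decides between (1), (2), (3) and
  (5).\<close>

lemma canonical_log_of_middle_nonzero:
  fixes x :: "'k::field poly"
  assumes two: "(2::'k) \<noteq> 0" and p: "p \<ge> 2" and log: "commuting_log p x y z u v w" and "y \<noteq> 0"
  shows "\<exists>N. equivalent_matrix (strict_upper x y z u v w) N \<and> canonical_log p N"
proof -
  note closed = p_polynomial_add [OF p] p_polynomial_smult [OF p]
  have pp: "p_polynomial p x" "p_polynomial p y" "p_polynomial p z"
      "p_polynomial p u" "p_polynomial p v" "p_polynomial p w"
    and xy: "\<And>i j. coeff x i * coeff y j = coeff x j * coeff y i"
    and zy: "\<And>i j. coeff z i * coeff y j = coeff z j * coeff y i"
    and sym: "\<And>i j. coeff x i * coeff v j + coeff u i * coeff z j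
        = coeff x j * coeff v i + coeff u j * coeff z i"
    using log by (auto simp: commuting_log_def mult.commute)
  obtain \<alpha> where x: "x = smult \<alpha> y"
    using symmetric_imp_proportional [OF \<open>y \<noteq> 0\<close> xy] .
  obtain \<beta> where z: "z = smult \<beta> y"
    using symmetric_imp_proportional [OF \<open>y \<noteq> 0\<close> zy] .
  consider "\<alpha> \<noteq> 0" "\<beta> \<noteq> 0" | "\<alpha> \<noteq> 0" "\<beta> = 0" | "\<alpha> = 0" "\<beta> \<noteq> 0" | "\<alpha> = 0" "\<beta> = 0"
    by blast
  then show ?thesis
  proof cases
    case 1
    define u' v' w' where "u' = smult (1/\<alpha>) u" and "v' = smult (1/\<beta>) v" and "w' = smult (1/(\<alpha>*\<beta>)) w"
    have uvw: "u = smult \<alpha> u'" "v = smult \<beta> v'"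
      using 1 by (simp_all add: u'_def v'_def)
    \<comment> \<open>The scaling factors are chosen so that all three superdiagonal entries become
      \<open>y\<close>.\<close>
    have "equivalent_matrix (strict_upper x y z u v w) (strict_upper y y y u' v' w')"
      using strict_upper_diag [of 1 "1/\<alpha>" "1/\<alpha>" "1/(\<alpha>*\<beta>)" x y z u v w] 1
      by (simp add: x z u'_def v'_def w'_def)
    moreover have "coeff (v' - u') i * coeff y j = coeff (v' - u') j * coeff y i" for i j
    proof -
      have "(\<alpha> * \<beta>) * (coeff (v' - u') i * coeff y j) = (\<alpha> * \<beta>) * (coeff (v' - u') j * coeff y i)"
        using sym [of j i] by (simp add: x z uvw algebra_simps)
      then show ?thesis using 1 by simp
    qed
    then obtain \<gamma> where \<gamma>: "v' - u' = smult \<gamma> y"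
      using symmetric_imp_proportional [OF \<open>y \<noteq> 0\<close>] by metis
    \<comment> \<open>The shear moves \<open>u'\<close> and \<open>v'\<close> in opposite
      directions, so half of their difference makes them meet.\<close>
    have "\<gamma> = \<gamma>/2 + \<gamma>/2"
      using two by (simp add: field_simps)
    then have "smult (\<gamma>/2) y + smult (\<gamma>/2) y = smult \<gamma> y"
      by (metis smult_add_left)
    then have v': "v' - smult (\<gamma>/2) y = u' + smult (\<gamma>/2) y"
      using \<gamma> by (simp add: algebra_simps)
    have "equivalent_matrix (strict_upper y y y u' v' w')
        (strict_upper y y y (u' + smult (\<gamma>/2) y) (u' + smult (\<gamma>/2) y) w')"
      using strict_upper_shear(1) [of y y y u' v' w' "\<gamma>/2"] by (simp only: v')
    moreover have "canonical_log p (strict_upper y y y (u' + smult (\<gamma>/2) y) (u' + smult (\<gamma>/2) y) w')"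
      unfolding canonical_log_def using \<open>y \<noteq> 0\<close>
      by (intro disjI1 exI conjI) (auto simp: u'_def w'_def intro!: closed pp)
    ultimately show ?thesis
      using equivalent_matrix_trans by blast
  next
    case 2
    define u' w' where "u' = smult (1/\<alpha>) u" and "w' = smult (1/\<alpha>) w"
    have "equivalent_matrix (strict_upper x y z u v w) (strict_upper y y 0 u' v w')"
      using strict_upper_diag [of 1 "1/\<alpha>" "1/\<alpha>" "1/\<alpha>" x y z u v w] 2
      by (simp add: x z u'_def w'_def)
    moreover have "coeff v i * coeff y j = coeff v j * coeff y i" for i j
      using sym [of j i] 2 by (simp add: x z mult.commute)
    then obtain \<gamma> where \<gamma>: "v = smult \<gamma> y"
      using symmetric_imp_proportional [OF \<open>y \<noteq> 0\<close>] by metis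
    \<comment> \<open>Since \<open>v\<close> is a multiple of \<open>y\<close>, a shear clears it at
      the cost of changing the corner.\<close>
    have "equivalent_matrix (strict_upper y y 0 u' v w') (strict_upper y y 0 u' 0 (w' + smult (-\<gamma>) u'))"
      using strict_upper_shear(2) [of y y 0 u' v w' "-\<gamma>"] by (simp add: \<gamma>)
    moreover have "canonical_log p (strict_upper y y 0 u' 0 (w' + smult (-\<gamma>) u'))"
      unfolding canonical_log_def using \<open>y \<noteq> 0\<close>
      by (intro disjI2 [THEN disjI2] disjI1 disjI2 exI conjI)
         (auto simp: u'_def w'_def simp del: smult_minus_left intro!: closed pp)
    ultimately show ?thesis
      using equivalent_matrix_trans by blast
  next
    case 3
    define v' w' where "v' = smult (1/\<beta>) v" and "w' = smult (1/\<beta>) w"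
    have "equivalent_matrix (strict_upper x y z u v w) (strict_upper 0 y y u v' w')"
      using strict_upper_diag [of 1 1 1 "1/\<beta>" x y z u v w] 3
      by (simp add: x z v'_def w'_def)
    moreover have "coeff u i * coeff y j = coeff u j * coeff y i" for i j
      using sym [of i j] 3 by (simp add: x z mult.left_commute)
    then obtain \<gamma> where \<gamma>: "u = smult \<gamma> y"
      using symmetric_imp_proportional [OF \<open>y \<noteq> 0\<close>] by metis
    have "equivalent_matrix (strict_upper 0 y y u v' w') (strict_upper 0 y y 0 v' (w' + smult (-\<gamma>) v'))"
      using strict_upper_shear(3) [of 0 y y u v' w' "\<gamma>"] by (simp add: \<gamma>)
    moreover have "canonical_log p (strict_upper 0 y y 0 v' (w' + smult (-\<gamma>) v'))"
      unfolding canonical_log_def using \<open>y \<noteq> 0\<close>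
      by (intro disjI2 [THEN disjI2] disjI1 disjI2 exI conjI)
         (auto simp: v'_def w'_def simp del: smult_minus_left intro!: closed pp)
    ultimately show ?thesis
      using equivalent_matrix_trans by blast
  next
    case 4
    then have "x = 0" "z = 0"
      by (simp_all add: x z)
    then have "canonical_log p (strict_upper x y z u v w)"
      unfolding canonical_log_def using pp by blast
    then show ?thesis
      using equivalent_matrix_refl by blast
  qed
qed

section \<open>Logarithms with zero entry (2,3)\<close>

text \<open>The alternative \<open>f = 0\<close> stands apart because \<open>g\<close> is then in
  general no multiple of \<open>f\<close>.\<close>

lemma not_lin_indep_pair_iff:
  "\<not> lin_indep_pair f g \<longleftrightarrow> (\<exists>c. g = smult c f) \<or> f = 0"
proof
  assume "\<not> lin_indep_pair f g"
  then obtain a b where ab: "smult a f + smult b g = 0" "a \<noteq> 0 \<or> b \<noteq> 0"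
    by (auto simp: lin_indep_pair_def)
  show "(\<exists>c. g = smult c f) \<or> f = 0"
  proof (cases "b = 0")
    case False
    have "g = smult (1/b) (smult b g)" using False by simp
    also have "smult b g = smult (-a) f" using ab(1) by (simp add: eq_neg_iff_add_eq_0 add.commute)
    finally show ?thesis by (auto simp only: smult_smult)
  qed (use ab in simp)
next
  assume "(\<exists>c. g = smult c f) \<or> f = 0"
  then show "\<not> lin_indep_pair f g"
  proof
    assume "\<exists>c. g = smult c f"
    then obtain c where "g = smult c f" by blast
    then have "smult (-c) f + smult 1 g = 0" by simp
    then show ?thesis unfolding lin_indep_pair_def by (metis one_neq_zero)
  next
    assume "f = 0"
    then have "smult 1 f + smult 0 g = 0" by simp
    then show ?thesis unfolding lin_indep_pair_def by (metis one_neq_zero)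
  qed
qed

text \<open>Independence provides indices \<open>i\<close>, \<open>j\<close> with a nonzero minor
  \<open>D\<close>, and Cramer's rule at these indices expresses \<open>v\<close> and
  \<open>z\<close> through \<open>x\<close> and \<open>u\<close>. The relation \<open>sym\<close>
  makes the resulting 2 by 2 matrix symmetric.\<close>

lemma symmetric_tensor_lin_indep:
  fixes x u v z :: "'k::field poly"
  assumes indep: "lin_indep_pair x u"
    and sym: "\<And>i j. coeff x i * coeff v j + coeff u i * coeff z j
      = coeff x j * coeff v i + coeff u j * coeff z i"
  obtains l m n where "v = smult l x + smult m u" "z = smult m x + smult n u"
proof -
  have "\<exists>i j. coeff x i * coeff u j - coeff x j * coeff u i \<noteq> 0"
  proof (rule ccontr)
    assume no_minor: "\<nexists>i j. coeff x i * coeff u j - coeff x j * coeff u i \<noteq> 0"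
    have minors: "coeff u i * coeff x j = coeff u j * coeff x i" for i j
    proof -
      have "coeff x i * coeff u j - coeff x j * coeff u i = 0"
        using no_minor by blast
      then show ?thesis by (metis mult.commute right_minus_eq)
    qed
    show False
    proof (cases "x = 0")
      case False
      then obtain c where "u = smult c x"
        using symmetric_imp_proportional minors by blast
      then show False
        using indep not_lin_indep_pair_iff [of x u] by blast
    qed (use indep not_lin_indep_pair_iff [of x u] in blast)
  qed
  then obtain i j where D_ne: "coeff x i * coeff u j - coeff x j * coeff u i \<noteq> 0"
    by blast
  define D where "D = coeff x i * coeff u j - coeff x j * coeff u i"
  define l where "l = (coeff u j * coeff v i - coeff u i * coeff v j) / D"
  define m where "m = (coeff u j * coeff z i - coeff u i * coeff z j) / D"
  define n where "n = (coeff x i * coeff z j - coeff x j * coeff z i) / D"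
  have "D \<noteq> 0" using D_ne by (simp add: D_def)
  \<comment> \<open>The instance of \<open>sym\<close> at \<open>i\<close>, \<open>j\<close> says
    exactly that the two off-diagonal entries agree.\<close>
  have m': "m = (coeff x i * coeff v j - coeff x j * coeff v i) / D"
    using sym [of i j] by (simp add: m_def algebra_simps)
  have lmn: "D * l = coeff u j * coeff v i - coeff u i * coeff v j"
    "D * m = coeff u j * coeff z i - coeff u i * coeff z j"
    "D * m = coeff x i * coeff v j - coeff x j * coeff v i"
    "D * n = coeff x i * coeff z j - coeff x j * coeff z i"
    using \<open>D \<noteq> 0\<close> by (simp_all add: l_def n_def) (simp add: m_def, simp add: m')
  have "coeff v k = l * coeff x k + m * coeff u k \<and> coeff z k = m * coeff x k + n * coeff u k" for k
  proof -
    \<comment> \<open>A term in \<open>coeff z k\<close> is added and subtracted so that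
      \<open>sym\<close> applies to both brackets.\<close>
    have "D * coeff v k = coeff u j * (coeff x i * coeff v k + coeff u i * coeff z k)
        - coeff u i * (coeff x j * coeff v k + coeff u j * coeff z k)"
      by (simp add: D_def algebra_simps)
    also have "\<dots> = (D * l) * coeff x k + (D * m) * coeff u k"
      unfolding lmn(1,2) sym [of i k] sym [of j k] by (simp add: algebra_simps)
    finally have v: "D * coeff v k = D * (l * coeff x k + m * coeff u k)"
      by (simp add: algebra_simps)
    have "D * coeff z k = coeff x i * (coeff x j * coeff v k + coeff u j * coeff z k)
        - coeff x j * (coeff x i * coeff v k + coeff u i * coeff z k)"
      by (simp add: D_def algebra_simps)
    also have "\<dots> = (D * m) * coeff x k + (D * n) * coeff u k"
      unfolding lmn(3,4) sym [of i k] sym [of j k] by (simp add: algebra_simps)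
    finally have z: "D * coeff z k = D * (m * coeff x k + n * coeff u k)"
      by (simp add: algebra_simps)
    show ?thesis using v z \<open>D \<noteq> 0\<close> by simp
  qed
  then have "v = smult l x + smult m u" "z = smult m x + smult n u"
    by (simp_all add: poly_eq_iff)
  then show ?thesis using that by blast
qed

text \<open>Exchanging the last two basis vectors puts the nonzero \<open>smult c x\<close> into
  position (2,3), which is the case already settled.\<close>

lemma canonical_log_of_rank_one:
  fixes x :: "'k::field poly"
  assumes two: "(2::'k) \<noteq> 0" and p: "p \<ge> 2"
    and pp: "p_polynomial p x" "p_polynomial p u" "p_polynomial p w"
    and "x \<noteq> 0" "c \<noteq> 0"
  shows "\<exists>N. equivalent_matrix (strict_upper x 0 0 u (smult c x) w) N \<and> canonical_log p N"
proof -
  have "commuting_log p x (smult c x) 0 w 0 u"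
    using pp p_polynomial_smult [OF p] by (auto simp: commuting_log_def p_polynomial_0)
  then obtain N where "equivalent_matrix (strict_upper x (smult c x) 0 w 0 u) N" "canonical_log p N"
    using canonical_log_of_middle_nonzero [OF two p] assms by (metis smult_eq_0_iff)
  then show ?thesis
    using strict_upper_permute_1243 equivalent_matrix_trans by blast
qed

text \<open>If \<open>x = 0\<close>, this is (6); otherwise a permutation puts \<open>x\<close> into
  position (2,3).\<close>

lemma canonical_log_of_single:
  fixes x :: "'k::field poly"
  assumes two: "(2::'k) \<noteq> 0" and p: "p \<ge> 2"
    and pp: "p_polynomial p x" "p_polynomial p z" "p_polynomial p v" "p_polynomial p w"
    and sym: "\<And>i j. coeff x i * coeff v j = coeff x j * coeff v i"
  shows "\<exists>N. equivalent_matrix (strict_upper x 0 z 0 v w) N \<and> canonical_log p N"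
proof (cases "x = 0")
  case True
  then have "canonical_log p (strict_upper x 0 z 0 v w)"
    unfolding canonical_log_def using pp by blast
  then show ?thesis
    using equivalent_matrix_refl by blast
next
  case False
  have "commuting_log p 0 x v 0 w z"
    using pp sym by (auto simp: commuting_log_def p_polynomial_0)
  then obtain N where "equivalent_matrix (strict_upper 0 x v 0 w z) N" "canonical_log p N"
    using canonical_log_of_middle_nonzero [OF two p] False by metis
  then show ?thesis
    using strict_upper_permute_3124 equivalent_matrix_trans by blast
qed

lemma canonical_log_of_middle_zero:
  fixes x :: "'k::field poly"
  assumes two: "(2::'k) \<noteq> 0" and p: "p \<ge> 2" and log: "commuting_log p x 0 z u v w"
  shows "\<exists>N. equivalent_matrix (strict_upper x 0 z u v w) N \<and> canonical_log p N"
proof -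
  note closed = p_polynomial_add [OF p] p_polynomial_smult [OF p]
  have pp: "p_polynomial p x" "p_polynomial p z" "p_polynomial p u" "p_polynomial p v" "p_polynomial p w"
    and sym: "\<And>i j. coeff x i * coeff v j + coeff u i * coeff z j
        = coeff x j * coeff v i + coeff u j * coeff z i"
    using log by (auto simp: commuting_log_def)
  show ?thesis
  proof (cases "lin_indep_pair x u")
    case indep: True
    obtain l m n where v: "v = smult l x + smult m u" and z: "z = smult m x + smult n u"
      using symmetric_tensor_lin_indep [OF indep sym] .
    \<comment> \<open>The split follows the rank of the symmetric matrix: 2, 0, and twice 1. In rank
      1 with \<open>l = 0\<close>, the vanishing determinant forces \<open>m = 0\<close>.\<close>
    consider "l * n - m^2 \<noteq> 0" | "l = 0" "m = 0" "n = 0" | "l * n = m^2" "l \<noteq> 0"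
      | "l = 0" "m = 0" "n \<noteq> 0"
      by fastforce
    then show ?thesis
    proof cases
      case 1
      then have "canonical_log p (strict_upper x 0 z u v w)"
        unfolding canonical_log_def v z using pp indep by blast
      then show ?thesis
        using equivalent_matrix_refl by blast
    next
      case 2
      then have "v = 0" "z = 0"
        by (simp_all add: v z)
      moreover have "canonical_log p (strict_upper x 0 0 u 0 w)"
        unfolding canonical_log_def
        by (rule disjI2, rule disjI2, rule disjI2, rule disjI1) (use pp(1,3,5) in blast)
      ultimately have "canonical_log p (strict_upper x 0 z u v w)"
        by simp
      then show ?thesis
        using equivalent_matrix_refl by blast
    next
      case 3
      \<comment> \<open>A rank one form is \<open>l\<close> times a square; \<open>x'\<close> is its
        linear form, so that \<open>v = smult l x'\<close> and
        \<open>z = smult (m/l) v\<close>.\<close>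
      define x' where "x' = x + smult (m/l) u"
      have "smult 1 x + smult (m/l) u \<noteq> 0"
        using indep unfolding lin_indep_pair_def by (metis one_neq_zero)
      then have "x' \<noteq> 0" by (simp add: x'_def)
      have "m / l * m = n"
        using 3 by (simp add: nonzero_divide_eq_eq power2_eq_square mult.commute)
      then have "v = smult l x'" "smult (1/1) z - smult (m/l/1) v = 0"
        using 3(2) by (simp_all add: v z x'_def smult_add_right)
      then have "equivalent_matrix (strict_upper x 0 z u v w) (strict_upper x' 0 0 u (smult l x') w)"
        using strict_upper_block [of 1 1 0 "m/l" 1 x z u v w] by (simp add: x'_def)
      moreover obtain N where "equivalent_matrix (strict_upper x' 0 0 u (smult l x') w) N" "canonical_log p N"
        using canonical_log_of_rank_one [OF two p _ pp(3,5) \<open>x' \<noteq> 0\<close> 3(2)] pp closed x'_def by blast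
      ultimately show ?thesis
        using equivalent_matrix_trans by blast
    next
      case 4
      have "u \<noteq> 0"
        using indep not_lin_indep_pair_iff by (metis smult_0_left)
      \<comment> \<open>The block matrix exchanges the two middle basis vectors, hence the
        determinant -1.\<close>
      have "equivalent_matrix (strict_upper x 0 z u v w) (strict_upper u 0 0 x (smult n u) w)"
        using strict_upper_block [of 0 0 1 1 "-1" x z u v w] 4 by (simp add: v z)
      moreover obtain N where "equivalent_matrix (strict_upper u 0 0 x (smult n u) w) N" "canonical_log p N"
        using canonical_log_of_rank_one [OF two p pp(3,1,5) \<open>u \<noteq> 0\<close> 4(3)] by blast
      ultimately show ?thesis
        using equivalent_matrix_trans by blast
    qed
  next
    case False
    then consider c where "u = smult c x" | "x = 0"
      using not_lin_indep_pair_iff by blast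
    then show ?thesis
    proof cases
      case (1 c)
      \<comment> \<open>Subtracting \<open>c\<close> times the second basis vector from the third
        clears \<open>u\<close>.\<close>
      have "equivalent_matrix (strict_upper x 0 z u v w) (strict_upper x 0 z 0 (v + smult c z) w)"
        using strict_upper_block [of 1 1 "-c" 0 1 x z u v w] 1 by simp
      moreover have "coeff x i * coeff (v + smult c z) j = coeff x j * coeff (v + smult c z) i" for i j
        using sym [of i j] by (simp add: 1 algebra_simps)
      then obtain N where "equivalent_matrix (strict_upper x 0 z 0 (v + smult c z) w) N" "canonical_log p N"
        using canonical_log_of_single [OF two p pp(1,2) _ pp(5)] pp closed by metis
      ultimately show ?thesis
        using equivalent_matrix_trans by blast
    next
      case 2
      have "equivalent_matrix (strict_upper x 0 z u v w) (strict_upper u 0 v 0 z w)"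
        using strict_upper_block [of 0 0 1 1 "-1" x z u v w] 2 by simp
      moreover obtain N where "equivalent_matrix (strict_upper u 0 v 0 z w) N" "canonical_log p N"
        using canonical_log_of_single [OF two p pp(3,4,2,5)] sym by (auto simp: 2)
      ultimately show ?thesis
        using equivalent_matrix_trans by blast
    qed
  qed
qed

section \<open>Exponentials of the canonical logarithms\<close>

lemma exp_matrix_canonical:
  fixes a b c d :: "'k::field poly"
  assumes two: "(2::'k) \<noteq> 0"
  shows "exp_matrix (strict_upper a a a b b c) = vector
          [vector [1, a, smult (1/2) (a^2) + b, smult (1/6) (a^3) + a * b + c],
           vector [0, 1, a, smult (1/2) (a^2) + b],
           vector [0, 0, 1, a],
           vector [0, 0, 0, 1]]" (is ?form1)
    and "exp_matrix (strict_upper a a 0 b 0 c) = vector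
          [vector [1, a, smult (1/2) (a^2) + b, c],
           vector [0, 1, a, 0],
           vector [0, 0, 1, 0],
           vector [0, 0, 0, 1]]" (is ?form2)
    and "exp_matrix (strict_upper 0 a a 0 b c) = vector
          [vector [1, 0, 0, c],
           vector [0, 1, a, smult (1/2) (a^2) + b],
           vector [0, 0, 1, a],
           vector [0, 0, 0, 1]]" (is ?form3)
    and "exp_matrix (strict_upper a 0 0 b 0 c) = vector
          [vector [1, a, b, c],
           vector [0, 1, 0, 0],
           vector [0, 0, 1, 0],
           vector [0, 0, 0, 1]]" (is ?form4)
    and "exp_matrix (strict_upper 0 c 0 a d b) = vector
          [vector [1, 0, a, b],
           vector [0, 1, c, d],
           vector [0, 0, 1, 0],
           vector [0, 0, 0, 1]]" (is ?form5)
    and "exp_matrix (strict_upper 0 0 c 0 b a) = vector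
          [vector [1, 0, 0, a],
           vector [0, 1, 0, b],
           vector [0, 0, 1, c],
           vector [0, 0, 0, 1]]" (is ?form6)
    and "exp_matrix (strict_upper a 0 (smult m a + smult n b) b (smult l a + smult m b) c) = vector
          [vector [1, a, b, smult (l/2) (a^2) + smult m (a * b) + smult (n/2) (b^2) + c],
           vector [0, 1, 0, smult l a + smult m b],
           vector [0, 0, 1, smult m a + smult n b],
           vector [0, 0, 0, 1]]" (is ?form7)
proof -
  have half: "r / 2 + r / 2 = r" for r :: 'k
    using two by (simp add: field_simps)
  \<comment> \<open>In the corner entry both orders of the product occur with factor 1/2, and they
    merge because 2 is invertible.\<close>
  have "smult (1/2) (a * b) + smult (1/2) (b * a) = a * b"
    using half [of 1] by (simp add: mult.commute flip: smult_add_left)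
  then have ab: "smult (1/2) (a * b + b * a) = a * b"
    by (simp only: smult_add_right)
  show ?form1
    unfolding exp_matrix_strict_upper ab
    by (simp add: power2_eq_square power3_eq_cube add_ac)
  have "smult (m/2) (a * b) + smult (m/2) (b * a) = smult m (a * b)"
    using half [of m] by (simp add: mult.commute flip: smult_add_left)
  then have quad: "smult (1/2) (a * (smult l a + smult m b) + b * (smult m a + smult n b))
      = smult (l/2) (a^2) + smult m (a * b) + smult (n/2) (b^2)"
    by (simp add: smult_add_right distrib_left power2_eq_square add_ac)
  show ?form7
    unfolding exp_matrix_strict_upper quad by (simp add: add_ac)
  show ?form2 ?form3 ?form4 ?form5 ?form6
    by (simp_all add: exp_matrix_strict_upper power2_eq_square add.commute)
qed

theorem theorem4p5:
  fixes A :: "'k::field poly^4^4" and p :: nat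
  assumes "CHAR('k) = p" and "p \<ge> 5"
    and "exponential_matrix A"
  shows "\<exists>B :: 'k poly^4^4. exponential_matrix B \<and> equivalent_matrix A B \<and>
    ((\<exists>a b c. p_polynomial p a \<and> p_polynomial p b \<and> p_polynomial p c \<and> a \<noteq> 0 \<and>
        B = vector
          [vector [1, a, smult (1/2) (a^2) + b, smult (1/6) (a^3) + a * b + c],
           vector [0, 1, a, smult (1/2) (a^2) + b],
           vector [0, 0, 1, a],
           vector [0, 0, 0, 1]])
   \<or> (\<exists>a b c. p_polynomial p a \<and> p_polynomial p b \<and> p_polynomial p c \<and> a \<noteq> 0 \<and>
        B = vector
          [vector [1, a, smult (1/2) (a^2) + b, c],
           vector [0, 1, a, 0],
           vector [0, 0, 1, 0],
           vector [0, 0, 0, 1]])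
   \<or> (\<exists>a b c. p_polynomial p a \<and> p_polynomial p b \<and> p_polynomial p c \<and> a \<noteq> 0 \<and>
        B = vector
          [vector [1, 0, 0, c],
           vector [0, 1, a, smult (1/2) (a^2) + b],
           vector [0, 0, 1, a],
           vector [0, 0, 0, 1]])
   \<or> (\<exists>a b c. p_polynomial p a \<and> p_polynomial p b \<and> p_polynomial p c \<and>
        B = vector
          [vector [1, a, b, c],
           vector [0, 1, 0, 0],
           vector [0, 0, 1, 0],
           vector [0, 0, 0, 1]])
   \<or> (\<exists>a b c d. p_polynomial p a \<and> p_polynomial p b \<and> p_polynomial p c \<and> p_polynomial p d \<and>
        B = vector
          [vector [1, 0, a, b],
           vector [0, 1, c, d],
           vector [0, 0, 1, 0],
           vector [0, 0, 0, 1]])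
   \<or> (\<exists>a b c. p_polynomial p a \<and> p_polynomial p b \<and> p_polynomial p c \<and>
        B = vector
          [vector [1, 0, 0, a],
           vector [0, 1, 0, b],
           vector [0, 0, 1, c],
           vector [0, 0, 0, 1]])
   \<or> (\<exists>a b c l m n. p_polynomial p a \<and> p_polynomial p b \<and> p_polynomial p c \<and>
        lin_indep_pair a b \<and> l * n - m^2 \<noteq> 0 \<and>
        B = vector
          [vector [1, a, b, smult (l/2) (a^2) + smult m (a * b) + smult (n/2) (b^2) + c],
           vector [0, 1, 0, smult l a + smult m b],
           vector [0, 0, 1, smult m a + smult n b],
           vector [0, 0, 0, 1]]))"
proof -
  have p2: "p \<ge> 2" using assms(2) by simp
  have "\<not> p dvd 2"
    using assms(2) by (auto dest: dvd_imp_le)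
  then have two: "(2::'k) \<noteq> 0"
    using of_nat_eq_0_iff_char_dvd [where 'a = 'k, of 2] assms(1) by simp
  obtain a12 a13 a14 a23 a24 a34 where U: "equivalent_matrix A (vector [vector [1, a12, a13, a14],
      vector [0, 1, a23, a24], vector [0, 0, 1, a34], vector [0, 0, 0, 1]])"
    using exponential_matrix_unitriangular [OF assms(3)] .
  obtain x y z u v w where equiv: "equivalent_matrix A (exp_matrix (strict_upper x y z u v w))"
    and log: "commuting_log p x y z u v w"
    using exponential_matrix_log [OF assms(1,2) refl equivalent_matrix_exponential [OF U assms(3)]] U
    unfolding commuting_log_def by metis
  obtain N where N: "equivalent_matrix (strict_upper x y z u v w) N" "canonical_log p N"
    using canonical_log_of_middle_zero [OF two p2] canonical_log_of_middle_nonzero [OF two p2] log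
    by metis
  have equiv_N: "equivalent_matrix A (exp_matrix N)"
    using equiv exp_matrix_equivalent [OF N(1)] by (rule equivalent_matrix_trans)
  show ?thesis
  proof (intro exI [of _ "exp_matrix N"] conjI)
    show "exponential_matrix (exp_matrix N)"
      using equiv_N assms(3) by (rule equivalent_matrix_exponential)
    show "equivalent_matrix A (exp_matrix N)"
      by (rule equiv_N)
  \<comment> \<open>The seven disjuncts of \<open>canonical_log\<close> match those of the goal in
    order, and each matrix equation is an instance of \<open>exp_matrix_canonical\<close>.\<close>
  qed (use N(2) in \<open>unfold canonical_log_def, elim disj_forward ex_forward conj_forward;
      (assumption | simp only: exp_matrix_canonical [OF two] not_False_eq_True)\<close>)
qed

end
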